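(* Assume (i) each $f_i$ is convex and $L_i$-smooth, and (ii) $f$ is $\mu$-strongly convex. Let $T$ be the number of iterations, $1\le\beta<T$, $\alpha=(\beta/T)^{1/T}$, $\nu>0$, and run SGD, $w_{k+1}=w_k-\gamma_k\alpha_k\nabla f_{i_k}(w_k)$, with $\alpha_k=\left(\frac\beta T\right)^{k/T}$ and $\gamma_k=\frac\nu L$. Then $$\Delta_{T+1}\le\Delta_1\,c_2\exp\left(-\frac{\min\{\nu,1\}\,T}{\kappa}\frac{\alpha}{\ln(T/\beta)}\right)+\max\{\nu^2,1\}\,\frac{8c_2\kappa\ln(T/\beta)}{\mu\,e^2\alpha^2T}\left[2\sigma^2\ln(T/\beta)+G\,[\ln\nu]_+\right],$$ where $\Delta_k:=\mathbb{E}\|w_k-w^*\|^2$, $c_2=\exp\left(\frac1\kappa\frac{2\beta}{\ln(T/\beta)}\right)$, $[x]_+=\max\{x,0\}$, $k_0=\left\lfloor T\frac{[\ln\nu]_+}{\ln(T/\beta)}\right\rfloor$ and $G=\mathbb{E}\left[\max_{j\in\{1,\dots,k_0\}}\{f(w_j)-f^*\}\right]$.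
   Context: $f:\mathbb{R}^d\to\mathbb{R}$ is $f(w)=\frac1n\sum_{i=1}^nf_i(w)$, where each $f_i:\mathbb{R}^d\to\mathbb{R}$ is differentiable and bounded below, with infimum $f_i^*$. $L_i$-smooth means $f_i(v)\le f_i(w)+\langle\nabla f_i(w),v-w\rangle+\frac{L_i}{2}\|v-w\|^2$ for all $v,w$. $f$ is $\mu$-strongly convex ($\mu>0$) if $f(v)\ge f(w)+\langle\nabla f(w),v-w\rangle+\frac\mu2\|v-w\|^2$ for all $v,w$. Set $L:=\max_iL_i$, $\kappa:=L/\mu$, let $w^*$ be the unique minimizer of $f$, $f^*=f(w^* )$, and let $\sigma^2:=\mathbb{E}_i[f_i(w^* )-f_i^*]=\frac1n\sum_i(f_i(w^* )-f_i^* )$. In SGD, $w_1$ is a deterministic starting point and the indices $i_k$ are drawn independently and uniformly from $\{1,\dots,n\}$; $\mathbb{E}$ is over all these draws. Conventions: the maximum over an empty index set ($k_0=0$) is $0$; if $k_0>T$ the iterates $w_j$ with $j>T+1$ are those obtained by continuing the same recursion. *)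

theory Defs
  imports "HOL-Probability.Probability"
begin

(* Meaningful only where f is differentiable; differentiability and the sign of the modulus mu
   are not part of the definitions below and have to be assumed separately. *)
definition grad :: "('a::euclidean_space \<Rightarrow> real) \<Rightarrow> 'a \<Rightarrow> 'a" where
  "grad f w = (THE D. GDERIV f w :> D)"

definition smooth_with :: "real \<Rightarrow> ('a::euclidean_space \<Rightarrow> real) \<Rightarrow> bool" where
  "smooth_with L f \<longleftrightarrow>
     (\<forall>v w. f v \<le> f w + inner (grad f w) (v - w) + L / 2 * (norm (v - w))\<^sup>2)"

definition strongly_convex :: "real \<Rightarrow> ('a::euclidean_space \<Rightarrow> real) \<Rightarrow> bool" where
  "strongly_convex \<mu> f \<longleftrightarrow>
     (\<forall>v w. f v \<ge> f w + inner (grad f w) (v - w) + \<mu> / 2 * (norm (v - w))\<^sup>2)"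

definition pos_part :: "real \<Rightarrow> real" where
  "pos_part x = max x 0"

end

theory Submission
  imports Defs
begin

text \<open>
  Write \<open>\<eta> k = \<nu> * \<alpha> ^ k / L\<close> for the step size. Expanding \<open>\<parallel>w (k + 1) - w_star\<parallel>\<^sup>2\<close>, averaging over the
  fresh index, and using strong convexity of \<open>f\<close> and \<open>\<parallel>grad (fs i) v\<parallel>\<^sup>2 \<le> 2 L (fs i v - inf (fs i))\<close> gives
  (lemma \<open>expected_distance_recursion\<close>)

    \<open>\<Delta> (k + 1) \<le> (1 - \<mu> \<eta> k) \<Delta> k - 2 \<eta> k (1 - L \<eta> k) E [f (w k) - f_star] + 2 L (\<eta> k)\<^sup>2 \<sigma>sq\<close>.

  For \<open>k > k0\<close> the step size is at most \<open>1 / L\<close> and the middle term can be dropped. For \<open>k \<le> k0\<close> it may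
  have the wrong sign, but it is at most \<open>2 L (\<eta> k)\<^sup>2 G\<close>, so that \<open>G\<close> merely joins \<open>\<sigma>sq\<close> during these
  steps. With \<open>c = min \<nu> 1 / \<kappa>\<close> one has \<open>1 - \<mu> \<eta> k \<le> exp (- c \<alpha> ^ k)\<close>, and the recursion unrolls to a
  contracted initial distance plus noise terms, the one of step \<open>k\<close> weighted by
  \<open>(\<alpha> ^ k)\<^sup>2 exp (- c (\<alpha> ^ (k + 1) + \<dots> + \<alpha> ^ T))\<close>.

  Since \<open>\<alpha> ^ T = \<beta> / T\<close>, the geometric sums in the exponents are \<open>\<alpha> ^ (k + 1) / (1 - \<alpha>)\<close> up to an error
  of at most \<open>\<beta> / ln (T / \<beta>)\<close>, which is absorbed in \<open>c2\<close>. For \<open>k = 0\<close> this yields the exponential term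
  (\<open>exp_schedule_contraction\<close>). For the noise, \<open>x\<^sup>2 e\<^sup>-\<^sup>x \<le> 4 / e\<^sup>2\<close> bounds every weight by the same
  quantity of order \<open>(ln (T / \<beta>) / (c T))\<^sup>2\<close> (\<open>exp_schedule_noise_weight\<close>). Summed over all \<open>T\<close> steps it
  multiplies \<open>\<sigma>sq\<close>; over the first \<open>k0 \<le> T [ln \<nu>]\<^sub>+ / ln (T / \<beta>)\<close> steps it multiplies \<open>G\<close>, which is where
  the factor \<open>[ln \<nu>]\<^sub>+\<close> comes from.
\<close>

section \<open>Gradients, smoothness and strong convexity\<close>

lemma grad_eqI: "GDERIV f w :> D \<Longrightarrow> grad f w = D"
  unfolding grad_def gderiv_def
  by (rule the_equality) (auto dest: has_derivative_unique[of f _ w] simp: fun_eq_iff vector_eq_ldot)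

text \<open>The constant \<^const>\<open>grad\<close> is a definite description, hence meaningful only once a gradient
  exists; on a Euclidean space the Riesz representation of the derivative provides one.\<close>

lemma GDERIV_grad:
  assumes "f differentiable (at w)"
  shows "GDERIV f w :> grad f w"
proof -
  from assms obtain f' where f': "(f has_derivative f') (at w)"
    by (auto simp: differentiable_def)
  define D where "D = (\<Sum>b\<in>Basis. f' b *\<^sub>R b)"
  have lin: "linear f'" using f' by (rule has_derivative_linear)
  have "f' h = inner h D" for h
  proof -
    have "f' h = f' (\<Sum>b\<in>Basis. inner h b *\<^sub>R b)" by (simp add: euclidean_representation)
    also have "\<dots> = (\<Sum>b\<in>Basis. inner h b * f' b)"
      using lin by (simp add: linear_sum linear_scale)
    finally show ?thesis by (simp add: D_def inner_sum_right mult.commute)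
  qed
  then have "GDERIV f w :> D" using f' by (simp add: gderiv_def) (metis ext)
  then show ?thesis using grad_eqI by metis
qed

lemma GDERIV_scaled_sum:
  assumes "\<And>i. i \<in> A \<Longrightarrow> GDERIV (F i) w :> D i"
  shows "GDERIV (\<lambda>v. c * (\<Sum>i\<in>A. F i v)) w :> c *\<^sub>R (\<Sum>i\<in>A. D i)"
proof -
  have "((\<lambda>v. c * (\<Sum>i\<in>A. F i v)) has_derivative (\<lambda>h. c * (\<Sum>i\<in>A. inner h (D i)))) (at w)"
    using assms unfolding gderiv_def by (intro derivative_intros) auto
  then show ?thesis by (simp add: gderiv_def inner_sum_right)
qed

lemma grad_scaled_sum:
  assumes "\<And>i. i \<in> A \<Longrightarrow> F i differentiable (at w)"
  shows "grad (\<lambda>v. c * (\<Sum>i\<in>A. F i v)) w = c *\<^sub>R (\<Sum>i\<in>A. grad (F i) w)"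
  using assms by (intro grad_eqI GDERIV_scaled_sum GDERIV_grad)

lemma smooth_with_mono: "smooth_with l f \<Longrightarrow> l \<le> L \<Longrightarrow> smooth_with L f"
  unfolding smooth_with_def by (smt (verit) divide_right_mono mult_right_mono zero_le_power2)

lemma smooth_with_average:
  assumes "n \<ge> 1" "\<And>i w. i \<in> {1..n} \<Longrightarrow> F i differentiable (at w)"
    "\<And>i. i \<in> {1..n} \<Longrightarrow> smooth_with L (F i)"
  defines "f \<equiv> (\<lambda>v. (1 / real n) * (\<Sum>i=1..n. F i v))"
  shows "smooth_with L f"
  unfolding smooth_with_def
proof (intro allI)
  fix v w
  have g: "grad f w = (1 / real n) *\<^sub>R (\<Sum>i=1..n. grad (F i) w)"
    unfolding f_def using assms(2) by (rule grad_scaled_sum)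
  have "(\<Sum>i=1..n. F i v) \<le> (\<Sum>i=1..n. F i w + inner (grad (F i) w) (v - w) + L / 2 * (norm (v - w))\<^sup>2)"
    using assms(3) by (intro sum_mono) (auto simp: smooth_with_def)
  also have "\<dots> = (\<Sum>i=1..n. F i w) + inner (\<Sum>i=1..n. grad (F i) w) (v - w) + n * (L / 2 * (norm (v - w))\<^sup>2)"
    by (simp add: sum.distrib inner_sum_left)
  finally have "f v \<le> (1 / real n) * \<dots>"
    unfolding f_def by (intro mult_left_mono) auto
  also have "\<dots> = f w + inner (grad f w) (v - w) + L / 2 * (norm (v - w))\<^sup>2"
    using assms(1) by (simp only: g) (simp add: f_def distrib_left)
  finally show "f v \<le> f w + inner (grad f w) (v - w) + L / 2 * (norm (v - w))\<^sup>2" .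
qed

text \<open>A gradient step of length \<open>1 / L\<close> decreases \<open>f\<close> by at least \<open>\<parallel>grad f w\<parallel>\<^sup>2 / (2 L)\<close>, and the
  result is still above the infimum. This is how the second moment of a stochastic gradient is
  controlled by function values.\<close>

lemma norm_grad_square_le_gap:
  assumes "smooth_with L f" "L > 0" "bdd_below (range f)"
  shows "(norm (grad f w))\<^sup>2 \<le> 2 * L * (f w - (INF v. f v))"
proof -
  define v where "v = w - (1 / L) *\<^sub>R grad f w"
  have "(INF v. f v) \<le> f v" using assms(3) by (intro cINF_lower) auto
  also have "f v \<le> f w + inner (grad f w) (v - w) + L / 2 * (norm (v - w))\<^sup>2"
    using assms(1) by (simp add: smooth_with_def)
  also have "\<dots> = f w - (norm (grad f w))\<^sup>2 / (2 * L)"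
    using assms(2) by (simp add: v_def dot_square_norm power_divide) (simp add: field_simps power2_eq_square)
  finally show ?thesis using assms(2) by (simp add: field_simps)
qed

text \<open>The quadratic lower bound at \<open>0\<close> pushes \<open>f\<close> above \<open>f 0\<close> outside a ball, so minimizing over that
  compact ball is enough.\<close>

lemma strongly_convex_attains_minimum:
  fixes f :: "'a::euclidean_space \<Rightarrow> real"
  assumes sc: "strongly_convex \<mu> f" and \<mu>: "\<mu> > 0" and cont: "continuous_on UNIV f"
  shows "\<exists>m. \<forall>v. f m \<le> f v"
proof -
  \<comment> \<open>beyond this radius the quadratic term outweighs the linear one\<close>
  define R where "R = 2 * norm (grad f 0) / \<mu>"
  have far: "f 0 \<le> f v" if "norm v \<ge> R" for v
  proof -
    have "f 0 + inner (grad f 0) v + \<mu> / 2 * (norm v)\<^sup>2 \<le> f v"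
      using sc unfolding strongly_convex_def by (metis diff_zero)
    moreover have "- (norm (grad f 0) * norm v) \<le> inner (grad f 0) v"
      using Cauchy_Schwarz_ineq2[of "grad f 0" v] by linarith
    moreover have "norm (grad f 0) * norm v \<le> (\<mu> / 2 * norm v) * norm v"
      using that \<mu> by (intro mult_right_mono) (auto simp: R_def field_simps)
    ultimately show ?thesis by (simp add: power2_eq_square)
  qed
  have "R \<ge> 0" using \<mu> by (simp add: R_def)
  then obtain m where m: "m \<in> cball 0 R" "\<And>v. v \<in> cball 0 R \<Longrightarrow> f m \<le> f v"
    using continuous_attains_inf[of "cball 0 R" f] cont continuous_on_subset
    by (metis centre_in_cball compact_cball empty_iff top_greatest)
  have "f m \<le> f v" for v
    using m(2)[of v] m(2)[of 0] far[of v] \<open>R \<ge> 0\<close> by (cases "norm v \<le> R") auto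
  then show ?thesis by blast
qed

text \<open>One step of SGD, averaged over the sampled index with the current point held fixed. Expanding
  the square gives an inner product, which strong convexity of the average bounds below, and a
  squared gradient, bounded by \<open>2 L\<close> times the gap of \<open>F i\<close>. Splitting that gap at \<open>z\<close> leaves,
  after averaging, the gap \<open>f w - f z\<close> and the noise. The coefficient \<open>1 - L * \<eta>\<close> may be negative:
  this is the regime of too large steps.\<close>

lemma average_gradient_step:
  fixes F :: "nat \<Rightarrow> 'a::euclidean_space \<Rightarrow> real"
  assumes "n \<ge> 1" and diff: "\<And>i. i \<in> {1..n} \<Longrightarrow> F i differentiable (at w)"
    and bdd: "\<And>i. i \<in> {1..n} \<Longrightarrow> bdd_below (range (F i))"
    and smooth: "\<And>i. i \<in> {1..n} \<Longrightarrow> smooth_with L (F i)" and "L > 0"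
  defines "f \<equiv> (\<lambda>v. (1 / real n) * (\<Sum>i=1..n. F i v))"
  assumes sc: "strongly_convex \<mu> f" and "\<eta> \<ge> 0"
  shows "(1 / real n) * (\<Sum>i=1..n. (norm (w - \<eta> *\<^sub>R grad (F i) w - z))\<^sup>2)
    \<le> (1 - \<mu> * \<eta>) * (norm (w - z))\<^sup>2 - 2 * \<eta> * (1 - L * \<eta>) * (f w - f z)
      + 2 * L * \<eta>\<^sup>2 * ((1 / real n) * (\<Sum>i=1..n. F i z - (INF v. F i v)))"
proof -
  let ?A = "\<lambda>h. (1 / real n) * (\<Sum>i=1..n. h i)"
  have g: "grad f w = (1 / real n) *\<^sub>R (\<Sum>i=1..n. grad (F i) w)"
    unfolding f_def using diff by (rule grad_scaled_sum)
  have "(norm (w - \<eta> *\<^sub>R grad (F i) w - z))\<^sup>2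
      \<le> (norm (w - z))\<^sup>2 - 2 * \<eta> * inner (grad (F i) w) (w - z)
        + \<eta>\<^sup>2 * (2 * L * ((F i w - F i z) + (F i z - (INF v. F i v))))" if "i \<in> {1..n}" for i
  proof -
    have "(norm (w - \<eta> *\<^sub>R grad (F i) w - z))\<^sup>2
      = (norm (w - z))\<^sup>2 - 2 * \<eta> * inner (grad (F i) w) (w - z) + \<eta>\<^sup>2 * (norm (grad (F i) w))\<^sup>2"
      unfolding power2_norm_eq_inner
      by (simp add: inner_diff_left inner_diff_right inner_commute algebra_simps power2_eq_square)
    moreover have "(norm (grad (F i) w))\<^sup>2 \<le> 2 * L * ((F i w - F i z) + (F i z - (INF v. F i v)))"
      using norm_grad_square_le_gap[OF smooth[OF that] \<open>L > 0\<close> bdd[OF that], of w] by simp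
    ultimately show ?thesis by (simp add: mult_left_mono)
  qed
  then have "?A (\<lambda>i. (norm (w - \<eta> *\<^sub>R grad (F i) w - z))\<^sup>2)
      \<le> ?A (\<lambda>i. (norm (w - z))\<^sup>2 - 2 * \<eta> * inner (grad (F i) w) (w - z)
        + \<eta>\<^sup>2 * (2 * L * ((F i w - F i z) + (F i z - (INF v. F i v)))))"
    by (intro mult_left_mono sum_mono) auto
  also have "\<dots> = (norm (w - z))\<^sup>2 - 2 * \<eta> * inner (grad f w) (w - z)
        + \<eta>\<^sup>2 * (2 * L * ((f w - f z) + ?A (\<lambda>i. F i z - (INF v. F i v))))"
    using \<open>n \<ge> 1\<close>
    by (simp only: g, simp add: f_def sum.distrib sum_subtractf flip: sum_distrib_left inner_sum_left)
       (simp add: field_simps)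
  also have "\<dots> \<le> (norm (w - z))\<^sup>2 - 2 * \<eta> * (f w - f z + \<mu> / 2 * (norm (w - z))\<^sup>2)
        + \<eta>\<^sup>2 * (2 * L * ((f w - f z) + ?A (\<lambda>i. F i z - (INF v. F i v))))"
  proof -
    have "f z \<ge> f w + inner (grad f w) (z - w) + \<mu> / 2 * (norm (z - w))\<^sup>2"
      using sc by (simp add: strongly_convex_def)
    then have "f w - f z + \<mu> / 2 * (norm (w - z))\<^sup>2 \<le> inner (grad f w) (w - z)"
      by (simp add: norm_minus_commute inner_diff_right)
    then show ?thesis using \<open>\<eta> \<ge> 0\<close> by (simp add: mult_left_mono)
  qed
  also have "\<dots> = (1 - \<mu> * \<eta>) * (norm (w - z))\<^sup>2 - 2 * \<eta> * (1 - L * \<eta>) * (f w - f z)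
      + 2 * L * \<eta>\<^sup>2 * ?A (\<lambda>i. F i z - (INF v. F i v))"
    by (simp add: algebra_simps power2_eq_square)
  finally show ?thesis .
qed

text \<open>Along a unit vector the quadratic lower bound lies below the quadratic upper one. In particular
  the smoothness constant of a strongly convex function is positive.\<close>

lemma strongly_convex_smooth_modulus_le:
  fixes f :: "'a::euclidean_space \<Rightarrow> real"
  assumes "strongly_convex \<mu> f" "smooth_with L f"
  shows "\<mu> \<le> L"
proof -
  obtain b :: 'a where "b \<in> Basis" using nonempty_Basis by blast
  then have "norm b = 1" by simp
  moreover have "f b \<ge> f 0 + inner (grad f 0) (b - 0) + \<mu> / 2 * (norm (b - 0))\<^sup>2"
    using assms(1) unfolding strongly_convex_def by blast
  moreover have "f b \<le> f 0 + inner (grad f 0) (b - 0) + L / 2 * (norm (b - 0))\<^sup>2"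
    using assms(2) unfolding smooth_with_def by blast
  ultimately show ?thesis by simp
qed

section \<open>The exponentially decaying schedule\<close>

text \<open>The maximum of \<open>x\<^sup>2 e\<^sup>-\<^sup>x\<close>, at \<open>x = 2\<close>; the square of the tangent bound \<open>e y \<le> e\<^sup>y\<close> at \<open>y = x / 2\<close>.\<close>

lemma square_times_exp_minus_le:
  fixes x :: real assumes "x \<ge> 0" shows "x\<^sup>2 * exp (- x) \<le> 4 / (exp 1)\<^sup>2"
proof -
  have "x / 2 * exp 1 \<le> exp (x / 2)"
  proof -
    have "x / 2 \<le> exp (x / 2) / exp 1"
      using exp_ge_add_one_self[of "x / 2 - 1"] by (simp add: exp_diff)
    then show ?thesis by (simp add: pos_le_divide_eq)
  qed
  then have "(x / 2 * exp 1)\<^sup>2 \<le> (exp (x / 2))\<^sup>2" using assms by (intro power_mono) auto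
  also have "\<dots> = exp x" by (simp flip: exp_double)
  finally show ?thesis by (simp add: exp_minus field_simps power2_eq_square)
qed

lemma one_minus_le_ln_inverse:
  fixes a :: real assumes "0 < a" shows "1 - a \<le> ln (1 / a)"
  using ln_le_minus_one[OF assms] assms by (simp add: ln_div)

lemma ln_inverse_le:
  fixes a :: real assumes "0 < a" shows "a * ln (1 / a) \<le> 1 - a"
proof -
  have "ln (1 / a) \<le> 1 / a - 1" using assms by (intro ln_le_minus_one) auto
  then show ?thesis using assms by (simp add: field_simps)
qed

lemma sum_power_tail:
  fixes a :: real assumes "a \<noteq> 1" "k \<le> T"
  shows "(\<Sum>i=Suc k..T. a ^ i) = (a ^ Suc k - a ^ Suc T) / (1 - a)"
  using sum_gp_multiplied[of "Suc k" T a] assms by (cases "k = T") (auto simp: eq_divide_eq mult.commute)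

lemma unroll_recursion:
  fixes D :: "nat \<Rightarrow> real"
  assumes "\<And>k. 1 \<le> k \<Longrightarrow> k \<le> T \<Longrightarrow> D (Suc k) \<le> exp (- (c * s k)) * D k + B k"
  shows "D (Suc T) \<le> exp (- (c * (\<Sum>i=1..T. s i))) * D 1
    + (\<Sum>k=1..T. exp (- (c * (\<Sum>i=Suc k..T. s i))) * B k)"
  using assms
proof (induction T)
  case 0 then show ?case by simp
next
  case (Suc T)
  let ?e = "exp (- (c * s (Suc T)))"
  have tail: "exp (- (c * (\<Sum>i=Suc k..Suc T. s i))) = ?e * exp (- (c * (\<Sum>i=Suc k..T. s i)))"
    if "k \<le> T" for k
    using that by (simp add: distrib_left flip: exp_add)
  have "D (Suc (Suc T)) \<le> ?e * D (Suc T) + B (Suc T)" using Suc.prems by simp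
  also have "\<dots> \<le> ?e * (exp (- (c * (\<Sum>i=1..T. s i))) * D 1
    + (\<Sum>k=1..T. exp (- (c * (\<Sum>i=Suc k..T. s i))) * B k)) + B (Suc T)"
    using Suc by (intro add_right_mono mult_left_mono) auto
  also have "\<dots> = exp (- (c * (\<Sum>i=1..Suc T. s i))) * D 1
    + (\<Sum>k=1..Suc T. exp (- (c * (\<Sum>i=Suc k..Suc T. s i))) * B k)"
  proof -
    have "(\<Sum>k=1..T. exp (- (c * (\<Sum>i=Suc k..Suc T. s i))) * B k)
        = ?e * (\<Sum>k=1..T. exp (- (c * (\<Sum>i=Suc k..T. s i))) * B k)"
      unfolding sum_distrib_left[of ?e] by (intro sum.cong refl) (simp only: tail atLeastAtMost_iff mult.assoc)
    then show ?thesis using tail[of 0] by (simp add: distrib_left)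
  qed
  finally show ?case .
qed

lemma exp_schedule_base:
  fixes \<beta> :: real
  assumes "0 < \<beta>" "\<beta> < real T"
  defines "\<alpha> \<equiv> (\<beta> / real T) powr (1 / real T)"
  shows "0 < \<alpha>" "\<alpha> < 1" "(\<beta> / real T) powr (real k / real T) = \<alpha> ^ k"
    "\<alpha> ^ T = \<beta> / real T" "ln (1 / \<alpha>) = ln (real T / \<beta>) / real T"
proof -
  have T: "real T > 0" using assms by linarith
  have q: "0 < \<beta> / real T" "\<beta> / real T < 1" using assms(1,2) T by auto
  show pos: "0 < \<alpha>" unfolding \<alpha>_def using assms(1) T by simp
  show lt: "\<alpha> < 1" unfolding \<alpha>_def using powr01_less_one[of "\<beta> / real T" "1 / real T"] assms(1,2) T by simp
  show pw: "(\<beta> / real T) powr (real k / real T) = \<alpha> ^ k" for k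
    using pos by (simp add: \<alpha>_def powr_powr flip: powr_realpow)
  show "\<alpha> ^ T = \<beta> / real T"
    using pw[of T] T assms(1) by simp
  show "ln (1 / \<alpha>) = ln (real T / \<beta>) / real T"
    using T assms by (simp add: \<alpha>_def ln_div ln_powr diff_divide_distrib)
qed

text \<open>In the geometric sum the subtracted end term \<open>\<alpha> ^ Suc T / (1 - \<alpha>)\<close> stays bounded, because
  \<open>\<alpha> ^ T = \<beta> / T\<close> cancels the growth of \<open>\<alpha> / (1 - \<alpha>) \<le> T / ln (T / \<beta>)\<close>. This end term is the
  origin of the factor \<open>c2\<close> in the rate.\<close>

lemma exp_schedule_sum_ge:
  fixes \<beta> :: real
  assumes "0 < \<beta>" "\<beta> < real T" "k \<le> T"
  defines "\<alpha> \<equiv> (\<beta> / real T) powr (1 / real T)"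
  shows "(\<Sum>i=Suc k..T. \<alpha> ^ i) \<ge> \<alpha> ^ Suc k / (1 - \<alpha>) - \<beta> / ln (real T / \<beta>)"
proof -
  note b = exp_schedule_base[OF assms(1,2), folded \<alpha>_def]
  have T: "real T > 0" using assms by linarith
  have ln: "ln (real T / \<beta>) > 0" using assms by auto
  have "\<alpha> / (1 - \<alpha>) \<le> real T / ln (real T / \<beta>)"
    using ln_inverse_le[OF b(1)] b(1,2) T ln by (simp add: b(5) field_simps)
  then have "\<alpha> / (1 - \<alpha>) * (\<beta> / real T) \<le> real T / ln (real T / \<beta>) * (\<beta> / real T)"
    using assms T by (intro mult_right_mono) auto
  then have "\<alpha> ^ Suc T / (1 - \<alpha>) \<le> \<beta> / ln (real T / \<beta>)"
    using T by (simp add: b(4) mult.commute)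
  then show ?thesis using sum_power_tail[of \<alpha> k T] b assms(3) by (simp add: diff_divide_distrib)
qed

lemma exp_schedule_contraction:
  fixes \<beta> c :: real
  assumes "0 < \<beta>" "\<beta> < real T" "c \<ge> 0"
  defines "\<alpha> \<equiv> (\<beta> / real T) powr (1 / real T)"
  shows "exp (- (c * (\<Sum>i=1..T. \<alpha> ^ i)))
    \<le> exp (c * \<beta> / ln (real T / \<beta>)) * exp (- (c * real T * \<alpha> / ln (real T / \<beta>)))"
proof -
  note b = exp_schedule_base[OF assms(1,2), folded \<alpha>_def]
  have T: "real T > 0" using assms by linarith
  have ln: "ln (real T / \<beta>) > 0" using assms by auto
  have "real T * \<alpha> / ln (real T / \<beta>) \<le> \<alpha> / (1 - \<alpha>)"
  proof -
    have "\<alpha> / (ln (real T / \<beta>) / real T) \<le> \<alpha> / (1 - \<alpha>)"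
      using one_minus_le_ln_inverse[OF b(1)] b(1,2) T ln
      by (intro divide_left_mono) (auto simp: b(5))
    then show ?thesis by (simp add: mult.commute)
  qed
  then have "real T * \<alpha> / ln (real T / \<beta>) - \<beta> / ln (real T / \<beta>) \<le> (\<Sum>i=1..T. \<alpha> ^ i)"
    using exp_schedule_sum_ge[OF assms(1,2), of 0] by (simp add: \<alpha>_def)
  then have "c * (real T * \<alpha> / ln (real T / \<beta>) - \<beta> / ln (real T / \<beta>)) \<le> c * (\<Sum>i=1..T. \<alpha> ^ i)"
    using assms(3) by (rule mult_left_mono)
  then show ?thesis unfolding exp_add[symmetric] by (simp add: algebra_simps)
qed

text \<open>The weight with which the noise of step \<open>k\<close> survives until the end. With
  \<open>x = c * \<alpha> ^ Suc k / (1 - \<alpha>)\<close> it is, up to the bounded end term, \<open>x\<^sup>2 e\<^sup>-\<^sup>x\<close> times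
  \<open>((1 - \<alpha>) / (\<alpha> c))\<^sup>2\<close>, and \<open>1 - \<alpha> \<le> ln (T / \<beta>) / T\<close>. The bound is uniform in \<open>k\<close>, so summing it over any block of steps costs only the length of the block.\<close>

lemma exp_schedule_noise_weight:
  fixes \<beta> c :: real
  assumes "0 < \<beta>" "\<beta> < real T" "c > 0" "k \<le> T"
  defines "\<alpha> \<equiv> (\<beta> / real T) powr (1 / real T)"
  shows "(\<alpha> ^ k)\<^sup>2 * exp (- (c * (\<Sum>i=Suc k..T. \<alpha> ^ i)))
    \<le> exp (c * \<beta> / ln (real T / \<beta>)) * (4 * (ln (real T / \<beta>))\<^sup>2 / ((exp 1)\<^sup>2 * \<alpha>\<^sup>2 * (real T)\<^sup>2 * c\<^sup>2))"
proof -
  note b = exp_schedule_base[OF assms(1,2), folded \<alpha>_def]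
  have T: "real T > 0" using assms by linarith
  define l where "l = ln (real T / \<beta>)"
  have ln: "l > 0" using assms by (auto simp: l_def)
  define x where "x = c * (\<alpha> ^ Suc k / (1 - \<alpha>))"
  have x: "x \<ge> 0" using b assms by (simp add: x_def)
  have ak: "(\<alpha> ^ k)\<^sup>2 = x\<^sup>2 * ((1 - \<alpha>)\<^sup>2 / (\<alpha>\<^sup>2 * c\<^sup>2))"
    using b assms by (simp add: x_def power_divide power_mult_distrib)
  have "c * (\<alpha> ^ Suc k / (1 - \<alpha>) - \<beta> / l) \<le> c * (\<Sum>i=Suc k..T. \<alpha> ^ i)"
    using exp_schedule_sum_ge[OF assms(1,2,4)] assms(3)
    by (intro mult_left_mono) (auto simp: \<alpha>_def l_def)
  then have "exp (- (c * (\<Sum>i=Suc k..T. \<alpha> ^ i))) \<le> exp (c * \<beta> / l) * exp (- x)"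
    unfolding exp_add[symmetric] by (simp add: x_def algebra_simps)
  then have "(\<alpha> ^ k)\<^sup>2 * exp (- (c * (\<Sum>i=Suc k..T. \<alpha> ^ i)))
     \<le> (\<alpha> ^ k)\<^sup>2 * (exp (c * \<beta> / l) * exp (- x))"
    by (intro mult_left_mono) auto
  also have "\<dots> = exp (c * \<beta> / l) * ((x\<^sup>2 * exp (- x)) * ((1 - \<alpha>)\<^sup>2 / (\<alpha>\<^sup>2 * c\<^sup>2)))"
    by (simp add: ak)
  also have "\<dots> \<le> exp (c * \<beta> / l) * ((4 / (exp 1)\<^sup>2) * ((l / real T)\<^sup>2 / (\<alpha>\<^sup>2 * c\<^sup>2)))"
  proof -
    have "(1 - \<alpha>)\<^sup>2 \<le> (l / real T)\<^sup>2"
      using one_minus_le_ln_inverse[OF b(1)] b by (intro power_mono) (auto simp: l_def)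
    then show ?thesis using square_times_exp_minus_le[OF x]
      by (intro mult_left_mono mult_mono divide_right_mono) auto
  qed
  also have "\<dots> = exp (c * \<beta> / l) * (4 * l\<^sup>2 / ((exp 1)\<^sup>2 * \<alpha>\<^sup>2 * (real T)\<^sup>2 * c\<^sup>2))"
    by (simp add: power_divide ac_simps)
  finally show ?thesis by (simp add: l_def)
qed

section \<open>Expectations over independent uniform indices\<close>

context prob_space begin

lemma measurable_restricted_indices:
  assumes "indep_vars (\<lambda>_. count_space A) I S" "finite A" "finite J" "J \<subseteq> S"
  shows "(\<lambda>x. \<lambda>i\<in>J. I i x) \<in> measurable M (count_space (J \<rightarrow>\<^sub>E A))"
proof -
  have "(\<lambda>x. \<lambda>i\<in>J. I i x) \<in> measurable M (PiM J (\<lambda>_. count_space A))"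
    using assms(1,4) by (intro measurable_restrict) (auto simp: indep_vars_def)
  then show ?thesis
    using assms(2,3) by (simp add: count_space_PiM_finite countable_finite)
qed

text \<open>Finitely many indices with finitely many values make every function of them bounded and
  measurable; evaluating any quantity at an iterate is such a function.\<close>

lemma integrable_function_of_indices:
  fixes h :: "('i \<Rightarrow> 'b) \<Rightarrow> real"
  assumes "indep_vars (\<lambda>_. count_space A) I S" "finite A" "finite J" "J \<subseteq> S"
  shows "integrable M (\<lambda>x. h (\<lambda>i\<in>J. I i x))"
proof (rule integrable_const_bound)
  note meas = measurable_restricted_indices[OF assms]
  have fin: "finite (J \<rightarrow>\<^sub>E A)" using assms by (intro finite_PiE)
  show "(\<lambda>x. h (\<lambda>i\<in>J. I i x)) \<in> borel_measurable M"
    using measurable_compose[OF meas, of h borel] by simp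
  show "AE x in M. norm (h (\<lambda>i\<in>J. I i x)) \<le> (\<Sum>\<omega>\<in>J \<rightarrow>\<^sub>E A. norm (h \<omega>))"
  proof (rule AE_I2)
    fix x assume "x \<in> space M"
    then have "(\<lambda>i\<in>J. I i x) \<in> J \<rightarrow>\<^sub>E A"
      using measurable_space[OF meas] by simp
    then show "norm (h (\<lambda>i\<in>J. I i x)) \<le> (\<Sum>\<omega>\<in>J \<rightarrow>\<^sub>E A. norm (h \<omega>))"
      using fin by (intro member_le_sum) auto
  qed
qed

text \<open>Replaces conditioning on the past: splitting \<open>\<Phi>\<close> along the values of \<open>I k\<close> turns it into a sum
  of products of an indicator of \<open>I k\<close> and a function of the other indices, and expectations of
  such products factor.\<close>

lemma expectation_fresh_uniform_index:
  fixes \<Phi> :: "'b \<Rightarrow> ('i \<Rightarrow> 'b) \<Rightarrow> real"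
  assumes indep: "indep_vars (\<lambda>_. count_space A) I S" and A: "finite A"
    and J: "finite J" "J \<subseteq> S" and k: "k \<in> S" "k \<notin> J"
    and unif: "distr M (count_space A) (I k) = uniform_count_measure A"
  shows "expectation (\<lambda>x. \<Phi> (I k x) (\<lambda>i\<in>J. I i x))
    = (1 / real (card A)) * (\<Sum>a\<in>A. expectation (\<lambda>x. \<Phi> a (\<lambda>i\<in>J. I i x)))"
proof -
  have Ik: "I k \<in> measurable M (count_space A)" using indep k by (auto simp: indep_vars_def)
  have prob_eq: "expectation (\<lambda>x. indicator {a} (I k x)) = 1 / real (card A)" if "a \<in> A" for a
  proof -
    have "expectation (\<lambda>x. indicator {a} (I k x)) = expectation (indicator (I k -` {a} \<inter> space M))"
      by (intro Bochner_Integration.integral_cong) (auto simp: indicator_def)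
    also have "\<dots> = measure (distr M (count_space A) (I k)) {a}"
      using Ik that by (simp add: measure_distr measurable_sets)
    also have "\<dots> = 1 / real (card A)"
      unfolding unif using A that by (simp add: measure_uniform_count_measure)
    finally show ?thesis .
  qed
  have "indep_var (PiM {k} (\<lambda>_. count_space A)) (\<lambda>x. \<lambda>i\<in>{k}. I i x)
      (PiM J (\<lambda>_. count_space A)) (\<lambda>x. \<lambda>i\<in>J. I i x)"
    using k J by (intro indep_var_restrict[OF indep]) auto
  then have iv: "indep_var (count_space ({k} \<rightarrow>\<^sub>E A)) (\<lambda>x. \<lambda>i\<in>{k}. I i x)
      (count_space (J \<rightarrow>\<^sub>E A)) (\<lambda>x. \<lambda>i\<in>J. I i x)"
    using A J by (simp add: count_space_PiM_finite countable_finite)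
  have split: "expectation (\<lambda>x. indicator {a} (I k x) * \<Phi> a (\<lambda>i\<in>J. I i x))
      = (1 / real (card A)) * expectation (\<lambda>x. \<Phi> a (\<lambda>i\<in>J. I i x))"
    and int: "integrable M (\<lambda>x. indicator {a} (I k x) * \<Phi> a (\<lambda>i\<in>J. I i x))" if "a \<in> A" for a
  proof -
    have 1: "indep_var borel ((\<lambda>r. indicator {a} (r k) :: real) \<circ> (\<lambda>x. \<lambda>i\<in>{k}. I i x))
        borel (\<Phi> a \<circ> (\<lambda>x. \<lambda>i\<in>J. I i x))"
      using iv by (rule indep_var_compose) auto
    have 2: "integrable M ((\<lambda>r. indicator {a} (r k) :: real) \<circ> (\<lambda>x. \<lambda>i\<in>{k}. I i x))"
      using integrable_function_of_indices[OF indep A, of "{k}" "\<lambda>r. indicator {a} (r k)"] k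
      by (simp add: comp_def)
    have 3: "integrable M (\<Phi> a \<circ> (\<lambda>x. \<lambda>i\<in>J. I i x))"
      using integrable_function_of_indices[OF indep A J] by (simp add: comp_def)
    show "expectation (\<lambda>x. indicator {a} (I k x) * \<Phi> a (\<lambda>i\<in>J. I i x))
        = (1 / real (card A)) * expectation (\<lambda>x. \<Phi> a (\<lambda>i\<in>J. I i x))"
      using indep_var_lebesgue_integral[OF 1 2 3] prob_eq[OF that] by (simp add: comp_def)
    show "integrable M (\<lambda>x. indicator {a} (I k x) * \<Phi> a (\<lambda>i\<in>J. I i x))"
      using indep_var_integrable[OF 1 2 3] by (simp add: comp_def)
  qed
  have "expectation (\<lambda>x. \<Phi> (I k x) (\<lambda>i\<in>J. I i x))
      = expectation (\<lambda>x. \<Sum>a\<in>A. indicator {a} (I k x) * \<Phi> a (\<lambda>i\<in>J. I i x))"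
  proof (rule Bochner_Integration.integral_cong[OF refl])
    fix x assume "x \<in> space M"
    then have "I k x \<in> A" using measurable_space[OF Ik] by simp
    then show "\<Phi> (I k x) (\<lambda>i\<in>J. I i x) = (\<Sum>a\<in>A. indicator {a} (I k x) * \<Phi> a (\<lambda>i\<in>J. I i x))"
      using A by (simp add: indicator_def of_bool_def if_distrib[of "\<lambda>c. c * _"] sum.delta' cong: if_cong)
  qed
  also have "\<dots> = (\<Sum>a\<in>A. expectation (\<lambda>x. indicator {a} (I k x) * \<Phi> a (\<lambda>i\<in>J. I i x)))"
    using int by (rule Bochner_Integration.integral_sum)
  also have "\<dots> = (1 / real (card A)) * (\<Sum>a\<in>A. expectation (\<lambda>x. \<Phi> a (\<lambda>i\<in>J. I i x)))"
    unfolding sum_distrib_left by (intro sum.cong refl split)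
  finally show ?thesis .
qed

end


section \<open>The expected distance of the iterates to a point\<close>

lemma iterate_depends_on_past:
  fixes w :: "nat \<Rightarrow> 'x \<Rightarrow> 'a"
  assumes "\<And>x. x \<in> X \<Longrightarrow> w 1 x = w1"
    and "\<And>k x. k \<ge> 1 \<Longrightarrow> x \<in> X \<Longrightarrow> w (k + 1) x = step k (I k x) (w k x)"
  shows "k \<ge> 1 \<Longrightarrow> \<exists>g. \<forall>x\<in>X. w k x = g (\<lambda>i\<in>{1..<k}. I i x)"
proof (induction k rule: nat_induct_at_least)
  case base
  show ?case using assms(1) by (intro exI[of _ "\<lambda>_. w1"]) auto
next
  case (Suc k)
  then obtain g where g: "\<And>x. x \<in> X \<Longrightarrow> w k x = g (\<lambda>i\<in>{1..<k}. I i x)" by blast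
  have "w (Suc k) x = step k ((\<lambda>i\<in>{1..<Suc k}. I i x) k) (g (restrict (\<lambda>i\<in>{1..<Suc k}. I i x) {1..<k}))"
    if "x \<in> X" for x
  proof -
    have "restrict (\<lambda>i\<in>{1..<Suc k}. I i x) {1..<k} = (\<lambda>i\<in>{1..<k}. I i x)"
      by (auto simp: restrict_def)
    then show ?thesis using assms(2)[OF Suc.hyps that] g[OF that] Suc.hyps by simp
  qed
  then show ?case
    by (intro exI[of _ "\<lambda>r. step k (r k) (g (restrict r {1..<k}))"]) blast
qed

context prob_space begin

lemma integrable_function_of_iterate:
  fixes h :: "'c \<Rightarrow> real" and w :: "nat \<Rightarrow> 'a \<Rightarrow> 'c"
  assumes indep: "indep_vars (\<lambda>_. count_space A) I {1..}" and A: "finite A"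
    and w1: "\<And>x. x \<in> space M \<Longrightarrow> w 1 x = w1"
    and rec: "\<And>k x. k \<ge> 1 \<Longrightarrow> x \<in> space M \<Longrightarrow> w (k + 1) x = step k (I k x) (w k x)"
    and k: "k \<ge> 1"
  shows "integrable M (\<lambda>x. h (w k x))"
proof -
  obtain g where g: "\<And>x. x \<in> space M \<Longrightarrow> w k x = g (\<lambda>i\<in>{1..<k}. I i x)"
    using iterate_depends_on_past[of "space M" w w1 step I k, OF w1 rec k] by blast
  have "integrable M (\<lambda>x. h (g (\<lambda>i\<in>{1..<k}. I i x)))"
    using indep A by (rule integrable_function_of_indices[where h="\<lambda>r. h (g r)"]) auto
  then show ?thesis
    by (simp add: g cong: Bochner_Integration.integrable_cong)
qed

lemma expectation_next_iterate:
  fixes h :: "'c \<Rightarrow> real" and w :: "nat \<Rightarrow> 'a \<Rightarrow> 'c"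
  assumes indep: "indep_vars (\<lambda>_. count_space A) I {1..}" and A: "finite A"
    and unif: "distr M (count_space A) (I k) = uniform_count_measure A"
    and w1: "\<And>x. x \<in> space M \<Longrightarrow> w 1 x = w1"
    and rec: "\<And>k x. k \<ge> 1 \<Longrightarrow> x \<in> space M \<Longrightarrow> w (k + 1) x = step k (I k x) (w k x)"
    and k: "k \<ge> 1"
  shows "expectation (\<lambda>x. h (w (k + 1) x))
    = expectation (\<lambda>x. (1 / real (card A)) * (\<Sum>a\<in>A. h (step k a (w k x))))"
proof -
  obtain g where g: "\<And>x. x \<in> space M \<Longrightarrow> w k x = g (\<lambda>i\<in>{1..<k}. I i x)"
    using iterate_depends_on_past[of "space M" w w1 step I k, OF w1 rec k] by blast
  have "expectation (\<lambda>x. h (w (k + 1) x))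
      = expectation (\<lambda>x. h (step k (I k x) (g (\<lambda>i\<in>{1..<k}. I i x))))"
    by (intro Bochner_Integration.integral_cong refl) (simp only: rec[OF k] g)
  also have "\<dots> = (1 / real (card A)) * (\<Sum>a\<in>A. expectation (\<lambda>x. h (step k a (g (\<lambda>i\<in>{1..<k}. I i x)))))"
    using k by (intro expectation_fresh_uniform_index[OF indep A _ _ _ _ unif, where \<Phi>="\<lambda>a r. h (step k a (g r))"]) auto
  also have "\<dots> = expectation (\<lambda>x. (1 / real (card A)) * (\<Sum>a\<in>A. h (step k a (g (\<lambda>i\<in>{1..<k}. I i x)))))"
    by (subst integral_mult_right_zero, subst Bochner_Integration.integral_sum)
       (auto intro!: integrable_function_of_indices[OF indep A, where h="\<lambda>r. h (step k _ (g r))"])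
  also have "\<dots> = expectation (\<lambda>x. (1 / real (card A)) * (\<Sum>a\<in>A. h (step k a (w k x))))"
    by (intro Bochner_Integration.integral_cong refl) (simp add: g)
  finally show ?thesis .
qed

lemma expected_distance_recursion:
  fixes F :: "nat \<Rightarrow> 'b::euclidean_space \<Rightarrow> real" and w :: "nat \<Rightarrow> 'a \<Rightarrow> 'b" and \<eta> :: "nat \<Rightarrow> real"
  assumes n: "n \<ge> 1" and diff: "\<And>i v. i \<in> {1..n} \<Longrightarrow> F i differentiable (at v)"
    and bdd: "\<And>i. i \<in> {1..n} \<Longrightarrow> bdd_below (range (F i))"
    and smooth: "\<And>i. i \<in> {1..n} \<Longrightarrow> smooth_with L (F i)" and "L > 0"
  defines "f \<equiv> (\<lambda>v. (1 / real n) * (\<Sum>i=1..n. F i v))"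
  assumes sc: "strongly_convex \<mu> f"
    and indep: "indep_vars (\<lambda>_. count_space {1..n}) I {1..}"
    and unif: "distr M (count_space {1..n}) (I k) = uniform_count_measure {1..n}"
    and w1: "\<And>x. x \<in> space M \<Longrightarrow> w 1 x = w1"
    and rec: "\<And>k x. k \<ge> 1 \<Longrightarrow> x \<in> space M \<Longrightarrow>
      w (k + 1) x = w k x - \<eta> k *\<^sub>R grad (F (I k x)) (w k x)"
    and k: "k \<ge> 1" and \<eta>: "\<eta> k \<ge> 0"
  shows "expectation (\<lambda>x. (norm (w (k + 1) x - z))\<^sup>2)
    \<le> (1 - \<mu> * \<eta> k) * expectation (\<lambda>x. (norm (w k x - z))\<^sup>2)
      - 2 * \<eta> k * (1 - L * \<eta> k) * expectation (\<lambda>x. f (w k x) - f z)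
      + 2 * L * (\<eta> k)\<^sup>2 * ((1 / real n) * (\<Sum>i=1..n. F i z - (INF v. F i v)))"
proof -
  let ?\<sigma> = "(1 / real n) * (\<Sum>i=1..n. F i z - (INF v. F i v))"
  let ?step = "\<lambda>k i v. v - \<eta> k *\<^sub>R grad (F i) v"
  have int: "integrable M (\<lambda>x. h (w k x))" for h :: "'b \<Rightarrow> real"
    by (rule integrable_function_of_iterate[where step="?step", OF indep _ w1 rec k]) auto
  have "expectation (\<lambda>x. (norm (w (k + 1) x - z))\<^sup>2)
     = expectation (\<lambda>x. (1 / real (card {1..n})) *
        (\<Sum>i\<in>{1..n}. (norm (w k x - \<eta> k *\<^sub>R grad (F i) (w k x) - z))\<^sup>2))"
    by (rule expectation_next_iterate[where step="?step", OF indep _ unif w1 rec k, of "\<lambda>v. (norm (v - z))\<^sup>2"]) auto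
  also have "\<dots> \<le> expectation (\<lambda>x. (1 - \<mu> * \<eta> k) * (norm (w k x - z))\<^sup>2
      - 2 * \<eta> k * (1 - L * \<eta> k) * (f (w k x) - f z) + 2 * L * (\<eta> k)\<^sup>2 * ?\<sigma>)"
    using average_gradient_step[OF n diff bdd smooth \<open>L > 0\<close> sc[unfolded f_def] \<eta>]
    by (intro integral_mono int) (auto simp: f_def)
  also have "\<dots> = (1 - \<mu> * \<eta> k) * expectation (\<lambda>x. (norm (w k x - z))\<^sup>2)
      - 2 * \<eta> k * (1 - L * \<eta> k) * expectation (\<lambda>x. f (w k x) - f z) + 2 * L * (\<eta> k)\<^sup>2 * ?\<sigma>"
    using int[of "\<lambda>v. (norm (v - z))\<^sup>2"] int[of f] by (simp add: prob_space)
  finally show ?thesis .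
qed

end

section \<open>Convergence with a misspecified smoothness constant\<close>

theorem theorem4:
  fixes n :: nat
    and fs :: "nat \<Rightarrow> real ^ 'd \<Rightarrow> real"
    and f :: "real ^ 'd \<Rightarrow> real"
    and Ls :: "nat \<Rightarrow> real"
    and L \<mu> \<kappa> \<sigma>sq f_star :: real
    and w_star w1 :: "real ^ 'd"
    and T :: nat
    and \<beta> \<nu> \<alpha> c2 G :: real
    and \<alpha>s \<gamma>s \<Delta> :: "nat \<Rightarrow> real"
    and k0 :: nat
    and M :: "'\<omega> measure"
    and I :: "nat \<Rightarrow> '\<omega> \<Rightarrow> nat"
    and w :: "nat \<Rightarrow> '\<omega> \<Rightarrow> real ^ 'd"
  defines "f \<equiv> (\<lambda>v. (1 / real n) * (\<Sum>i=1..n. fs i v))"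
    and "L \<equiv> Max (Ls ` {1..n})"
    and "\<kappa> \<equiv> L / \<mu>"
    and "w_star \<equiv> arg_min f (\<lambda>_. True)"
    and "f_star \<equiv> f w_star"
    and "\<sigma>sq \<equiv> (1 / real n) * (\<Sum>i=1..n. fs i w_star - (INF v. fs i v))"
    and "\<alpha> \<equiv> (\<beta> / real T) powr (1 / real T)"
    and "\<alpha>s \<equiv> (\<lambda>k. (\<beta> / real T) powr (real k / real T))"
    and "\<gamma>s \<equiv> (\<lambda>k. \<nu> / L)"
    and "\<Delta> \<equiv> (\<lambda>k. prob_space.expectation M (\<lambda>x. (norm (w k x - w_star))\<^sup>2))"
    and "c2 \<equiv> exp ((1 / \<kappa>) * (2 * \<beta> / ln (real T / \<beta>)))"
    and "k0 \<equiv> nat \<lfloor>real T * (pos_part (ln \<nu>) / ln (real T / \<beta>))\<rfloor>"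
    and "G \<equiv> prob_space.expectation M
               (\<lambda>x. if k0 = 0 then 0 else Max ((\<lambda>j. f (w j x) - f_star) ` {1..k0}))"
  assumes "n \<ge> 1"
    and "\<And>i v. i \<in> {1..n} \<Longrightarrow> fs i differentiable (at v)"
    and "\<And>i. i \<in> {1..n} \<Longrightarrow> bdd_below (range (fs i))"
    and "\<And>i. i \<in> {1..n} \<Longrightarrow> convex_on UNIV (fs i)"
    and "\<And>i. i \<in> {1..n} \<Longrightarrow> smooth_with (Ls i) (fs i)"
    and "\<mu> > 0"
    and "strongly_convex \<mu> f"
    and "1 \<le> \<beta>" and "\<beta> < real T"
    and "\<nu> > 0"
    and "prob_space M"
    and "prob_space.indep_vars M (\<lambda>_. count_space {1..n}) I {1..}"
    and "\<And>k. k \<ge> 1 \<Longrightarrow> distr M (count_space {1..n}) (I k) = uniform_count_measure {1..n}"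
    and "\<And>x. x \<in> space M \<Longrightarrow> w 1 x = w1"
    and "\<And>k x. k \<ge> 1 \<Longrightarrow> x \<in> space M \<Longrightarrow>
           w (k + 1) x = w k x - (\<gamma>s k * \<alpha>s k) *\<^sub>R grad (fs (I k x)) (w k x)"
  shows "\<Delta> (T + 1) \<le>
           \<Delta> 1 * c2 * exp (- (min \<nu> 1 * real T / \<kappa>) * (\<alpha> / ln (real T / \<beta>)))
           + max (\<nu>\<^sup>2) 1 * (8 * c2 * \<kappa> * ln (real T / \<beta>) / (\<mu> * (exp 1)\<^sup>2 * \<alpha>\<^sup>2 * real T))
             * (2 * \<sigma>sq * ln (real T / \<beta>) + G * pos_part (ln \<nu>))"
proof -
  note n = assms(14) and diff = assms(15) and bdd = assms(16) and smooth_i = assms(18)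
    and \<mu> = assms(19) and sc = assms(20) and \<beta>1 = assms(21) and \<beta>T = assms(22) and \<nu> = assms(23)
    and indep = assms(25) and unif = assms(26) and w1 = assms(27)
  interpret prob_space M by (fact assms(24))
  have \<beta>: "\<beta> > 0" using \<beta>1 by simp
  have T: "real T > 0" using \<beta> \<beta>T by linarith
  define l where "l = ln (real T / \<beta>)"
  have l: "l > 0" using \<beta> \<beta>T T by (simp add: l_def)
  note base = exp_schedule_base[OF \<beta> \<beta>T, folded \<alpha>_def]
  have \<alpha>s: "\<alpha>s k = \<alpha> ^ k" for k by (simp add: \<alpha>s_def base(3))

  have smooth: "smooth_with L (fs i)" if "i \<in> {1..n}" for i
    by (rule smooth_with_mono[OF smooth_i[OF that]]) (use that in \<open>simp add: L_def\<close>)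
  have "\<mu> \<le> L"
    using strongly_convex_smooth_modulus_le[OF sc[unfolded f_def] smooth_with_average[OF n diff smooth]]
    by simp
  then have L: "L > 0" using \<mu> by simp
  have \<kappa>: "\<kappa> > 0" using L \<mu> by (simp add: \<kappa>_def)
  have "continuous_on UNIV f"
    unfolding f_def
    by (intro continuous_intros continuous_at_imp_continuous_on ballI differentiable_imp_continuous_within diff)
  then obtain m0 where "\<forall>v. f m0 \<le> f v"
    using strongly_convex_attains_minimum[OF sc \<mu>] by blast
  then have f_star: "f_star \<le> f v" for v
    unfolding f_star_def w_star_def
    by (intro arg_minI[where P="\<lambda>_. True" and Q="\<lambda>m. f m \<le> f v" and x=m0]) (auto simp: not_less)
  have \<sigma>: "\<sigma>sq \<ge> 0"
    unfolding \<sigma>sq_def using bdd by (intro mult_nonneg_nonneg sum_nonneg) (auto intro!: cINF_lower)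

  define \<eta> where "\<eta> k = \<nu> * \<alpha> ^ k / L" for k
  have \<eta>: "\<eta> k \<ge> 0" for k using \<nu> L base(1) by (simp add: \<eta>_def)
  have rec: "w (k + 1) x = w k x - \<eta> k *\<^sub>R grad (fs (I k x)) (w k x)"
    if "k \<ge> 1" "x \<in> space M" for k x
    using assms(28)[OF that] by (simp add: \<gamma>s_def \<alpha>s \<eta>_def)
  have int: "integrable M (\<lambda>x. f (w k x) - f_star)" if "k \<ge> 1" for k
    by (rule integrable_function_of_iterate[where step="\<lambda>k i v. v - \<eta> k *\<^sub>R grad (fs i) v", OF indep _ w1 rec that]) auto
  have gap_nonneg: "expectation (\<lambda>x. f (w k x) - f_star) \<ge> 0" for k
    using f_star by (intro Bochner_Integration.integral_nonneg) simp

  have G_nonneg: "G \<ge> 0"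
    unfolding G_def by (intro Bochner_Integration.integral_nonneg) (auto simp: Max_ge_iff f_star intro!: bexI[of _ 1])
  \<comment> \<open>the maximum inside \<open>G\<close> is integrable because it is at most the sum of the nonnegative gaps\<close>
  have gap_le_G: "expectation (\<lambda>x. f (w k x) - f_star) \<le> G" if "1 \<le> k" "k \<le> k0" for k
  proof -
    let ?m = "\<lambda>x. Max ((\<lambda>j. f (w j x) - f_star) ` {1..k0})"
    have "integrable M ?m"
    proof (rule Bochner_Integration.integrable_bound)
      show "integrable M (\<lambda>x. \<Sum>j=1..k0. f (w j x) - f_star)" using int by auto
      show "?m \<in> borel_measurable M" using int by (intro borel_measurable_Max) auto
      show "AE x in M. norm (?m x) \<le> norm (\<Sum>j=1..k0. f (w j x) - f_star)"
      proof (rule AE_I2)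
        fix x
        have "?m x \<in> (\<lambda>j. f (w j x) - f_star) ` {1..k0}" using that by (intro Max_in) auto
        then obtain j where j: "j \<in> {1..k0}" "?m x = f (w j x) - f_star" by blast
        have "f (w j x) - f_star \<le> (\<Sum>j=1..k0. f (w j x) - f_star)"
          using j(1) f_star by (intro member_le_sum) auto
        then show "norm (?m x) \<le> norm (\<Sum>j=1..k0. f (w j x) - f_star)"
          using j(2) f_star[of "w j x"] by simp
      qed
    qed
    then have "expectation (\<lambda>x. f (w k x) - f_star) \<le> expectation ?m"
      using that by (intro Bochner_Integration.integral_mono int) auto
    then show ?thesis using that by (simp add: G_def)
  qed

  \<comment> \<open>contraction rate: for \<open>\<nu> > 1\<close> only the rate of the step size \<open>\<alpha> ^ k / L\<close> is kept\<close>
  define m where "m = min \<nu> 1"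
  have m: "0 < m" "m \<le> 1" "m \<le> \<nu>" using \<nu> by (auto simp: m_def)
  define c where "c = m / \<kappa>"
  have c: "c > 0" using m \<kappa> by (simp add: c_def)
  define p where "p = pos_part (ln \<nu>)"
  have p: "p \<ge> 0" "ln \<nu> \<le> p" by (auto simp: p_def pos_part_def)
  have k0_eq: "k0 = nat \<lfloor>real T * (p / l)\<rfloor>" by (simp add: k0_def p_def l_def)
  have k0_le: "real k0 \<le> real T * (p / l)"
    using p l T by (simp add: k0_eq)
  \<comment> \<open>after \<open>k0\<close> steps the step size has decayed below \<open>1 / L\<close>\<close>
  have late: "\<nu> * \<alpha> ^ k \<le> 1" if "k > k0" for k
  proof -
    have "real T * (p / l) < real k" using that unfolding k0_eq by linarith
    then have "p < real k * (l / real T)" using l T by (simp add: field_simps)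
    moreover have "ln \<alpha> = - (l / real T)" using base(1,5) by (simp add: ln_div l_def)
    ultimately have "ln (\<nu> * \<alpha> ^ k) \<le> 0"
      using p \<nu> base(1) by (simp add: ln_mult ln_realpow)
    then show ?thesis using \<nu> base(1) by simp
  qed

  \<comment> \<open>noise of step \<open>k\<close>; while the steps are too long the gap itself acts as additional noise\<close>
  define B where "B k = 2 * \<nu>\<^sup>2 / L * (\<alpha> ^ k)\<^sup>2 * (\<sigma>sq + (if k \<le> k0 then G else 0))" for k
  have step: "\<Delta> (Suc k) \<le> exp (- (c * \<alpha> ^ k)) * \<Delta> k + B k" if "1 \<le> k" "k \<le> T" for k
  proof -
    let ?E = "expectation (\<lambda>x. f (w k x) - f_star)"
    have sq: "2 * L * (\<eta> k)\<^sup>2 = 2 * \<nu>\<^sup>2 / L * (\<alpha> ^ k)\<^sup>2"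
      using L by (simp add: \<eta>_def power_mult_distrib power_divide power2_eq_square)
    have B: "B k = 2 * L * (\<eta> k)\<^sup>2 * (\<sigma>sq + (if k \<le> k0 then G else 0))"
      by (simp only: B_def sq)
    have \<Delta>0: "\<Delta> k \<ge> 0" unfolding \<Delta>_def by (intro Bochner_Integration.integral_nonneg) simp
    have "\<Delta> (Suc k) \<le> (1 - \<mu> * \<eta> k) * \<Delta> k - 2 * \<eta> k * (1 - L * \<eta> k) * ?E + 2 * L * (\<eta> k)\<^sup>2 * \<sigma>sq"
      using expected_distance_recursion[where F=fs and w=w and \<eta>=\<eta> and I=I and k=k and z=w_star,
          OF n diff bdd smooth L sc[unfolded f_def] indep unif[OF that(1)] w1 rec that(1) \<eta>]
      by (simp add: \<Delta>_def f_star_def \<sigma>sq_def f_def)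
    moreover have "(1 - \<mu> * \<eta> k) * \<Delta> k \<le> exp (- (c * \<alpha> ^ k)) * \<Delta> k"
    proof (rule mult_right_mono[OF _ \<Delta>0])
      have "c * \<alpha> ^ k \<le> \<mu> * \<eta> k"
        using m \<mu> L base(1) by (simp add: c_def \<kappa>_def \<eta>_def divide_right_mono mult_left_mono mult_right_mono mult.left_commute)
      then show "1 - \<mu> * \<eta> k \<le> exp (- (c * \<alpha> ^ k))"
        using exp_ge_add_one_self[of "- (c * \<alpha> ^ k)"] by linarith
    qed
    moreover have "- (2 * \<eta> k * (1 - L * \<eta> k) * ?E) + 2 * L * (\<eta> k)\<^sup>2 * \<sigma>sq \<le> B k"
    proof (cases "k \<le> k0")
      case True
      have "- (2 * \<eta> k * (1 - L * \<eta> k) * ?E) \<le> 2 * L * (\<eta> k)\<^sup>2 * ?E"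
        using \<eta> gap_nonneg by (simp add: algebra_simps power2_eq_square)
      also have "\<dots> \<le> 2 * L * (\<eta> k)\<^sup>2 * G"
        using gap_le_G[OF that(1) True] L by (intro mult_left_mono) auto
      finally show ?thesis using True by (simp only: B distrib_left if_True)
    next
      case False
      then have "1 - L * \<eta> k \<ge> 0" using late[of k] L by (simp add: \<eta>_def)
      then have "2 * \<eta> k * (1 - L * \<eta> k) * ?E \<ge> 0"
        using \<eta> gap_nonneg by (intro mult_nonneg_nonneg) auto
      then show ?thesis using False by (simp add: B)
    qed
    ultimately show ?thesis by linarith
  qed
  have unrolled: "\<Delta> (Suc T) \<le> exp (- (c * (\<Sum>i=1..T. \<alpha> ^ i))) * \<Delta> 1
      + (\<Sum>k=1..T. exp (- (c * (\<Sum>i=Suc k..T. \<alpha> ^ i))) * B k)"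
    by (rule unroll_recursion[of T \<Delta> c "\<lambda>k. \<alpha> ^ k" B, OF step])

  have c2: "exp (c * \<beta> / l) \<le> c2"
  proof -
    have "m * (\<beta> / (\<kappa> * l)) \<le> 2 * (\<beta> / (\<kappa> * l))"
      using m \<kappa> l \<beta> by (intro mult_right_mono) auto
    then show ?thesis by (simp add: c2_def c_def flip: l_def)
  qed
  have main: "exp (- (c * (\<Sum>i=1..T. \<alpha> ^ i))) * \<Delta> 1
      \<le> \<Delta> 1 * c2 * exp (- (min \<nu> 1 * real T / \<kappa>) * (\<alpha> / ln (real T / \<beta>)))"
  proof -
    have "exp (- (c * (\<Sum>i=1..T. \<alpha> ^ i))) \<le> exp (c * \<beta> / l) * exp (- (c * real T * \<alpha> / l))"
      using exp_schedule_contraction[OF \<beta> \<beta>T less_imp_le[OF c]] by (simp add: \<alpha>_def l_def)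
    also have "\<dots> \<le> c2 * exp (- (c * real T * \<alpha> / l))" using c2 by (intro mult_right_mono) auto
    finally have "exp (- (c * (\<Sum>i=1..T. \<alpha> ^ i))) * \<Delta> 1 \<le> (c2 * exp (- (c * real T * \<alpha> / l))) * \<Delta> 1"
      by (rule mult_right_mono) (auto simp: \<Delta>_def intro!: Bochner_Integration.integral_nonneg)
    then show ?thesis by (simp add: c_def m_def l_def ac_simps)
  qed

  define W where "W = c2 * (4 * l\<^sup>2 / ((exp 1)\<^sup>2 * \<alpha>\<^sup>2 * (real T)\<^sup>2 * c\<^sup>2))"
  have W: "W \<ge> 0" by (simp add: W_def c2_def)
  have "(\<Sum>k=1..T. exp (- (c * (\<Sum>i=Suc k..T. \<alpha> ^ i))) * B k)
      \<le> (\<Sum>k=1..T. 2 * \<nu>\<^sup>2 / L * W * (\<sigma>sq + (if k \<le> k0 then G else 0)))"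
  proof (rule sum_mono)
    fix k assume "k \<in> {1..T}"
    then have "(\<alpha> ^ k)\<^sup>2 * exp (- (c * (\<Sum>i=Suc k..T. \<alpha> ^ i)))
        \<le> exp (c * \<beta> / l) * (4 * l\<^sup>2 / ((exp 1)\<^sup>2 * \<alpha>\<^sup>2 * (real T)\<^sup>2 * c\<^sup>2))"
      using exp_schedule_noise_weight[OF \<beta> \<beta>T c] by (simp add: \<alpha>_def l_def)
    also have "\<dots> \<le> W" unfolding W_def using c2 by (intro mult_right_mono) auto
    finally have "2 * \<nu>\<^sup>2 / L * ((\<alpha> ^ k)\<^sup>2 * exp (- (c * (\<Sum>i=Suc k..T. \<alpha> ^ i)))) * (\<sigma>sq + (if k \<le> k0 then G else 0))
        \<le> 2 * \<nu>\<^sup>2 / L * W * (\<sigma>sq + (if k \<le> k0 then G else 0))"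
      using L \<sigma> G_nonneg by (intro mult_right_mono mult_left_mono) auto
    then show "exp (- (c * (\<Sum>i=Suc k..T. \<alpha> ^ i))) * B k
        \<le> 2 * \<nu>\<^sup>2 / L * W * (\<sigma>sq + (if k \<le> k0 then G else 0))"
      by (simp add: B_def ac_simps)
  qed
  also have "\<dots> = 2 * \<nu>\<^sup>2 / L * W * (real T * \<sigma>sq + real (card ({1..T} \<inter> {k. k \<le> k0})) * G)"
    by (simp only: sum_distrib_left[symmetric]) (simp add: sum.distrib sum.If_cases)
  also have "\<dots> \<le> 2 * \<nu>\<^sup>2 / L * W * (real T * (2 * \<sigma>sq) + real T * (p / l) * G)"
  proof -
    have "card ({1..T} \<inter> {k. k \<le> k0}) \<le> card {1..k0}" by (intro card_mono) auto
    then have "real (card ({1..T} \<inter> {k. k \<le> k0})) \<le> real T * (p / l)" using k0_le by simp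
    then show ?thesis using L W G_nonneg \<sigma>
      by (intro mult_left_mono add_mono mult_right_mono) auto
  qed
  also have "\<dots> = max (\<nu>\<^sup>2) 1 * (8 * c2 * \<kappa> * l / (\<mu> * (exp 1)\<^sup>2 * \<alpha>\<^sup>2 * real T)) * (2 * \<sigma>sq * l + G * p)"
  proof -
    \<comment> \<open>the factor \<open>1 / c\<^sup>2\<close> in \<open>W\<close> contributes \<open>1 / m\<^sup>2\<close>, which turns \<open>\<nu>\<^sup>2\<close> into the maximum\<close>
    have "\<nu>\<^sup>2 = max (\<nu>\<^sup>2) 1 * m\<^sup>2"
    proof (cases "\<nu> \<le> 1")
      case True
      then have "\<nu>\<^sup>2 \<le> 1" using \<nu> by (simp add: power_le_one)
      then show ?thesis using True by (simp add: m_def)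
    next
      case False
      then have "1 \<le> \<nu>\<^sup>2" by (simp add: one_le_power)
      then show ?thesis using False by (simp add: m_def)
    qed
    then have "2 * \<nu>\<^sup>2 / L * W = max (\<nu>\<^sup>2) 1 * (2 * m\<^sup>2 / L * W)" by simp
    also have "2 * m\<^sup>2 / L * W = 8 * c2 * \<kappa> * l / (\<mu> * (exp 1)\<^sup>2 * \<alpha>\<^sup>2 * real T) * (l / real T)"
      using m L \<mu> T base(1) by (simp add: W_def c_def \<kappa>_def field_simps power2_eq_square)
    finally have W_eq: "2 * \<nu>\<^sup>2 / L * W
      = max (\<nu>\<^sup>2) 1 * (8 * c2 * \<kappa> * l / (\<mu> * (exp 1)\<^sup>2 * \<alpha>\<^sup>2 * real T)) * (l / real T)"
      by (simp only: mult.assoc)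
    have "(l / real T) * (real T * (2 * \<sigma>sq) + real T * (p / l) * G) = 2 * \<sigma>sq * l + G * p"
      using T l by (simp add: distrib_left)
    then show ?thesis by (simp only: W_eq mult.assoc)
  qed
  finally show ?thesis using unrolled main by (simp add: l_def p_def)
qed

end
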